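(* Let $E$ be a finite set, $r\ge1$, and let $f:E^r\to\mathbb{Q}$ be a GP-function. Then for all $(a_1,\dots,a_r)\in E^r$ and $(b_1,\dots,b_r)\in E^r$, \[\sum_{\sigma\in\mathfrak{S}_r}\operatorname{sgn}(\sigma)\prod_{i=1}^r f(a_1,\dots,a_{i-1},b_{\sigma(i)},a_{i+1},\dots,a_r)=f(a_1,\dots,a_r)^{r-1}f(b_1,\dots,b_r),\] where $\operatorname{sgn}(\sigma)\in\{\pm1\}$ is the sign of the permutation $\sigma$.
   Context: A map $f:E^r\to\mathbb{Q}$ is a GP-function if it is alternating (i.e. $f(x_{\sigma(1)},\dots,x_{\sigma(r)})=\operatorname{sgn}(\sigma)f(x_1,\dots,x_r)$ for every permutation $\sigma$) and for all $x_2,\dots,x_r\in E$ and all $y_0,\dots,y_r\in E$, \[\sum_{i=0}^r(-1)^i f(y_i,x_2,\dots,x_r)\,f(y_0,\dots,y_{i-1},y_{i+1},\dots,y_r)=0.\] *)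

theory Defs
  imports Complex_Main "HOL-Library.NList" "HOL-Combinatorics.Permutations"
begin

text \<open>
  An element \<open>(x\<^sub>1, \<dots>, x\<^sub>r)\<close> of \<open>E\<^sup>r\<close> is a list in \<open>nlists r E\<close>, whose entry \<open>x ! i\<close> is
  \<open>x\<^sub>i\<^sub>+\<^sub>1\<close>. A map on \<open>E\<^sup>r\<close> is a function on all lists that is constrained only on \<open>nlists r E\<close>.
\<close>

definition alternating_on :: "nat \<Rightarrow> 'a set \<Rightarrow> ('a list \<Rightarrow> rat) \<Rightarrow> bool" where
  "alternating_on r E f \<longleftrightarrow>
     (\<forall>x \<in> nlists r E. \<forall>\<sigma>. \<sigma> permutes {..<r} \<longrightarrow>
        f (permute_list \<sigma> x) = of_int (sign \<sigma>) * f x)"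

definition GP_function :: "nat \<Rightarrow> 'a set \<Rightarrow> ('a list \<Rightarrow> rat) \<Rightarrow> bool" where
  "GP_function r E f \<longleftrightarrow>
     alternating_on r E f \<and>
     (\<forall>x \<in> nlists (r - 1) E. \<forall>y \<in> nlists (r + 1) E.
        (\<Sum>i\<le>r. (-1) ^ i * f (y ! i # x) * f (take i y @ drop (i + 1) y)) = 0)"

end

theory Submission
  imports Defs "Jordan_Normal_Form.Determinant"
begin

text \<open>
  Put \<open>M\<^sub>i\<^sub>j = f (a[i := b\<^sub>j])\<close>; the left-hand side is \<open>det M\<close>. The Grassmann--Pluecker relation says
  \<open>f a * f (c[p := b\<^sub>j]) = (\<Sum>i. M\<^sub>i\<^sub>j * f (c[p := a\<^sub>i]))\<close>, a form of Cramer's rule.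
  If \<open>f a \<noteq> 0\<close>, using it to replace all entries of \<open>b\<close> one after another by entries of \<open>a\<close> gives
  \<open>f a ^ r * f b = det M * f a\<close>. If \<open>f a = 0\<close> and \<open>M\<^sub>i\<^sub>j \<noteq> 0\<close> for some \<open>i\<close>, \<open>j\<close>, then for \<open>c = a[i := b\<^sub>j]\<close>
  and \<open>p \<noteq> i\<close> it says that the vector with entries \<open>f (c[p := a\<^sub>k])\<close>, which is nonzero at \<open>k = p\<close>,
  is annihilated by the transpose of \<open>M\<close>.
\<close>

section \<open>Alternating maps: repeated entries and signs of moves\<close>

lemma alternating_on_eq_0:
  assumes alt: "alternating_on r E f" and x: "x \<in> nlists r E"
    and ij: "i < r" "j < r" "i \<noteq> j" and eq: "x ! i = x ! j"
  shows "f x = 0"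
proof -
  let ?t = "transpose i j"
  have p: "?t permutes {..<r}"
    using ij by (intro permutes_swap_id) auto
  have "permute_list ?t x = x"
  proof (rule nth_equalityI)
    fix k assume "k < length (permute_list ?t x)"
    then show "permute_list ?t x ! k = x ! k"
      using p x eq by (auto simp: permute_list_nth transpose_def)
  qed simp
  moreover have "f (permute_list ?t x) = of_int (sign ?t) * f x"
    using alt x p unfolding alternating_on_def by blast
  ultimately show ?thesis
    using ij by (simp add: sign_swap_id)
qed

lemma alternating_on_swap_adjacent:
  assumes alt: "alternating_on r E f" and l: "us @ x # y # vs \<in> nlists r E"
  shows "f (us @ y # x # vs) = - f (us @ x # y # vs)"
proof -
  let ?n = "length us" and ?l = "us @ x # y # vs"
  let ?t = "transpose ?n (Suc ?n)"
  have len: "length ?l = r"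
    using l by (rule nlistsE_length)
  have p: "?t permutes {..<r}"
    using len by (intro permutes_swap_id) auto
  have "permute_list ?t ?l = us @ y # x # vs"
  proof (rule nth_equalityI)
    fix k assume "k < length (permute_list ?t ?l)"
    then have "permute_list ?t ?l ! k = ?l ! ?t k"
      using p len by (intro permute_list_nth) (simp_all only: length_permute_list)
    then show "permute_list ?t ?l ! k = (us @ y # x # vs) ! k"
      by (auto simp: transpose_def nth_append nth_Cons split: nat.splits)
  qed simp
  moreover have "f (permute_list ?t ?l) = of_int (sign ?t) * f ?l"
    using alt[unfolded alternating_on_def, rule_format, OF l p] .
  ultimately show ?thesis
    by (simp add: sign_swap_id)
qed

text \<open>Each adjacent swap that carries \<open>z\<close> one place to the right costs a factor
  -1. Peeling off the last entry of \<open>us\<close> hands it to the tail in the induction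
  hypothesis, so \<open>vs\<close> must stay arbitrary.\<close>

lemma alternating_on_move:
  assumes alt: "alternating_on r E f"
  shows "z # us @ vs \<in> nlists r E \<Longrightarrow> f (z # us @ vs) = (-1) ^ length us * f (us @ z # vs)"
proof (induction us arbitrary: vs rule: rev_induct)
  case (snoc u us)
  have "us @ z # u # vs \<in> nlists r E"
    using snoc.prems unfolding nlists_def by auto
  from alternating_on_swap_adjacent[OF alt this] show ?case
    using snoc by simp
qed simp

text \<open>Translates the shape of the Grassmann-Pluecker terms, a new entry in front of a list
  with one deletion, into replacement in place. The sign depends on the position alone, not on
  \<open>z\<close> or \<open>c\<close>.\<close>

lemma alternating_on_Cons_delete:
  assumes alt: "alternating_on r E f" and c: "c \<in> nlists r E" and z: "z \<in> E" and p: "p < r"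
  shows "f (z # take p c @ drop (Suc p) c) = (-1) ^ p * f (c[p := z])"
proof -
  have len: "length c = r"
    using c by simp
  have "set (take p c) \<subseteq> E" "set (drop (Suc p) c) \<subseteq> E"
    using nlistsE_set[OF c] set_take_subset[of p c] set_drop_subset[of "Suc p" c] by blast+
  then have "z # take p c @ drop (Suc p) c \<in> nlists r E"
    using len p z unfolding nlists_def by auto
  from alternating_on_move[OF alt this] show ?thesis
    using len p by (simp add: upd_conv_take_nth_drop)
qed

section \<open>The Grassmann-Pluecker relation as Cramer's rule\<close>

lemma GP_function_cramer:
  assumes gp: "GP_function r E f"
    and a: "a \<in> nlists r E" and c: "c \<in> nlists r E" and u: "u \<in> E" and p: "p < r"
  shows "f a * f (c[p := u]) = (\<Sum>i<r. f (a[i := u]) * f (c[p := a ! i]))"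
proof -
  have alt: "alternating_on r E f"
    using gp by (simp add: GP_function_def)
  \<comment> \<open>With these arguments the term at index 0 deletes \<open>u\<close> and gives the
    left-hand side up to sign; the term at index \<open>i + 1\<close> deletes \<open>a ! i\<close>
    from \<open>a\<close>.\<close>
  let ?x = "take p c @ drop (Suc p) c" and ?y = "u # a"
  have len: "length c = r" "length a = r"
    using a c by simp_all
  have "set (take p c) \<subseteq> E" "set (drop (Suc p) c) \<subseteq> E"
    using nlistsE_set[OF c] set_take_subset[of p c] set_drop_subset[of "Suc p" c] by blast+
  then have x: "?x \<in> nlists (r - 1) E"
    using len p unfolding nlists_def by auto
  have y: "?y \<in> nlists (r + 1) E"
    using a u by simp
  have "0 = (\<Sum>i\<le>r. (-1) ^ i * f (?y ! i # ?x) * f (take i ?y @ drop (i + 1) ?y))"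
    using gp[unfolded GP_function_def, THEN conjunct2, rule_format, OF x y] by simp
  also have "\<dots> = f (u # ?x) * f a
      + (\<Sum>i<r. (-1) ^ Suc i * f (a ! i # ?x) * f (u # take i a @ drop (Suc i) a))"
    by (subst sum.atMost_shift) simp
  \<comment> \<open>Moving \<open>u\<close> into place \<open>i\<close> of \<open>a\<close> costs
    \<open>(-1) ^ i\<close>, which turns \<open>(-1) ^ Suc i\<close> into -1. The sign
    \<open>(-1) ^ p\<close> is common to all terms and cancels at the end.\<close>
  also have "(\<Sum>i<r. (-1) ^ Suc i * f (a ! i # ?x) * f (u # take i a @ drop (Suc i) a))
      = (\<Sum>i<r. - ((-1) ^ p * (f (a[i := u]) * f (c[p := a ! i]))))"
  proof (rule sum.cong[OF refl])
    fix i assume "i \<in> {..<r}"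
    then have i: "i < r" by simp
    then have "a ! i \<in> E"
      using a by (intro nlistsE_nth_in)
    then show "(-1) ^ Suc i * f (a ! i # ?x) * f (u # take i a @ drop (Suc i) a)
        = - ((-1) ^ p * (f (a[i := u]) * f (c[p := a ! i])))"
      by (simp add: alternating_on_Cons_delete[OF alt c _ p] alternating_on_Cons_delete[OF alt a u i])
  qed
  also have "f (u # ?x) = (-1) ^ p * f (c[p := u])"
    by (rule alternating_on_Cons_delete[OF alt c u p])
  finally have "(-1) ^ p * (f a * f (c[p := u]) - (\<Sum>i<r. f (a[i := u]) * f (c[p := a ! i]))) = 0"
    by (simp add: sum_negf sum_distrib_left algebra_simps)
  then show ?thesis
    by simp
qed

section \<open>Expansion over all choices of replacement indices\<close>

text \<open>Outside \<open>{..<k}\<close> the functions are the identity, so that for \<open>k = r\<close> the injective ones are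
  exactly the permutations of \<open>{..<r}\<close>.\<close>

definition index_functions :: "nat \<Rightarrow> nat \<Rightarrow> (nat \<Rightarrow> nat) set" where
  "index_functions r k = {g. (\<forall>i\<in>{..<k}. g i \<in> {..<r}) \<and> (\<forall>i. i \<notin> {..<k} \<longrightarrow> g i = i)}"

lemma finite_index_functions: "finite (index_functions r k)"
  unfolding index_functions_def by (rule finite_bounded_functions) auto

lemma index_functions_0: "index_functions r 0 = {\<lambda>i. i}"
  by (auto simp: index_functions_def)

lemma sum_index_functions_Suc:
  "(\<Sum>g\<in>index_functions r (Suc k). T g) = (\<Sum>g\<in>index_functions r k. \<Sum>i<r. T (g(k := i)))"
proof -
  have "(\<Sum>g\<in>index_functions r (Suc k). T g)
      = (\<Sum>(g, i)\<in>index_functions r k \<times> {..<r}. T (g(k := i)))"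
    \<comment> \<open>The value at \<open>k\<close> becomes the second component; resetting it to
      \<open>k\<close> restores the identity outside \<open>{..<k}\<close>.\<close>
    by (rule sum.reindex_bij_witness[where j = "\<lambda>g. (g(k := k), g k)" and i = "\<lambda>(g, i). g(k := i)"])
      (auto simp: index_functions_def fun_eq_iff less_Suc_eq)
  then show ?thesis
    by (simp add: sum.cartesian_product)
qed

lemma permutes_index_functions:
  "{g. g permutes {..<r}} = {g \<in> index_functions r r. inj_on g {..<r}}"
proof (intro equalityI subsetI CollectI; elim CollectE)
  fix g assume g: "g permutes {..<r}"
  then show "g \<in> index_functions r r \<and> inj_on g {..<r}"
    using permutes_in_image[OF g] by (auto simp: index_functions_def permutes_inj_on permutes_not_in)
next
  fix g assume "g \<in> index_functions r r \<and> inj_on g {..<r}"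
  then have g: "g ` {..<r} \<subseteq> {..<r}" "\<And>i. i \<notin> {..<r} \<Longrightarrow> g i = i" and inj: "inj_on g {..<r}"
    by (auto simp: index_functions_def)
  have "bij_betw g {..<r} {..<r}"
    using endo_inj_surj[OF _ g(1) inj] inj by (simp add: bij_betw_def)
  then show "g permutes {..<r}"
    using g(2) by (rule bij_imp_permutes)
qed

text \<open>By induction on the number of replaced entries: one use of Cramer's rule at position
  \<open>k\<close> trades \<open>b ! k\<close> for a sum over the entries of \<open>a\<close>, and
  \<open>g k\<close> records which one was taken.\<close>

lemma GP_function_expand:
  assumes gp: "GP_function r E f" and a: "a \<in> nlists r E" and b: "b \<in> nlists r E"
  shows "k \<le> r \<Longrightarrow> f a ^ k * f b = (\<Sum>g\<in>index_functions r k. (\<Prod>j<k. f (a[g j := b ! j]))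
    * f (map (\<lambda>j. if j < k then a ! g j else b ! j) [0..<r]))"
proof (induction k)
  case 0
  have "map ((!) b) [0..<r] = b"
    using map_nth[of b] b by simp
  then show ?case
    by (simp add: index_functions_0)
next
  case (Suc k)
  then have k: "k < r" by simp
  let ?c = "\<lambda>k g. map (\<lambda>j. if j < k then a ! g j else b ! j) [0..<r]"
  have "f a ^ Suc k * f b = f a * (f a ^ k * f b)"
    by simp
  also have "\<dots> = (\<Sum>g\<in>index_functions r k. (\<Prod>j<k. f (a[g j := b ! j])) * (f a * f (?c k g)))"
    using Suc by (simp add: sum_distrib_left mult_ac)
  also have "\<dots> = (\<Sum>g\<in>index_functions r k. \<Sum>i<r.
      (\<Prod>j<Suc k. f (a[(g(k := i)) j := b ! j])) * f (?c (Suc k) (g(k := i))))"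
  proof (rule sum.cong[OF refl])
    fix g assume g: "g \<in> index_functions r k"
    have "set (?c k g) \<subseteq> E"
    proof
      fix z assume "z \<in> set (?c k g)"
      then obtain j where "j < r" "z = (if j < k then a ! g j else b ! j)"
        by auto
      then show "z \<in> E"
        using g by (auto simp: index_functions_def intro: nlistsE_nth_in[OF a] nlistsE_nth_in[OF b])
    qed
    then have c: "?c k g \<in> nlists r E"
      by (intro nlistsI) simp_all
    \<comment> \<open>Position \<open>k\<close> still holds \<open>b ! k\<close>, so Cramer's rule
      with \<open>u = b ! k\<close> and \<open>p = k\<close> has \<open>f a * f (?c k g)\<close> as
      its left-hand side.\<close>
    have upd: "(?c k g)[k := b ! k] = ?c k g"
      using k by (intro nth_equalityI) (auto simp: nth_list_update)
    have upd': "(?c k g)[k := a ! i] = ?c (Suc k) (g(k := i))" for i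
      using k by (intro nth_equalityI) (auto simp: nth_list_update)
    have "f a * f (?c k g) = (\<Sum>i<r. f (a[i := b ! k]) * f (?c (Suc k) (g(k := i))))"
      using GP_function_cramer[OF gp a c nlistsE_nth_in[OF b k] k] by (simp only: upd upd')
    then show "(\<Prod>j<k. f (a[g j := b ! j])) * (f a * f (?c k g)) = (\<Sum>i<r.
      (\<Prod>j<Suc k. f (a[(g(k := i)) j := b ! j])) * f (?c (Suc k) (g(k := i))))"
      by (simp add: sum_distrib_left mult_ac)
  qed
  also have "\<dots> = (\<Sum>g\<in>index_functions r (Suc k).
      (\<Prod>j<Suc k. f (a[g j := b ! j])) * f (?c (Suc k) g))"
    by (rule sum_index_functions_Suc[symmetric])
  finally show ?case .
qed

text \<open>Evaluates the lists left after all \<open>r\<close> replacements: a non-injective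
  \<open>g\<close> repeats an entry of \<open>a\<close>, so only permutations survive and the
  expansion becomes a determinant.\<close>

lemma alternating_on_index_function:
  assumes alt: "alternating_on r E f" and a: "a \<in> nlists r E" and g: "g \<in> index_functions r r"
  shows "f (map (\<lambda>j. a ! g j) [0..<r]) = (if g permutes {..<r} then of_int (sign g) * f a else 0)"
proof (cases "g permutes {..<r}")
  case True
  have "map (\<lambda>j. a ! g j) [0..<r] = permute_list g a"
    using a by (simp add: permute_list_def)
  then show ?thesis
    using alt[unfolded alternating_on_def, rule_format, OF a True] True by simp
next
  case False
  then have "\<not> inj_on g {..<r}"
    using g permutes_index_functions[of r] by blast
  then obtain i j where ij: "i < r" "j < r" "i \<noteq> j" "g i = g j"
    by (auto simp: inj_on_def)
  have "map (\<lambda>j. a ! g j) [0..<r] \<in> nlists r E"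
    using g by (intro nlistsI) (auto simp: index_functions_def intro: nlistsE_nth_in[OF a])
  from alternating_on_eq_0[OF alt this ij(1-3)] show ?thesis
    using False ij by simp
qed

section \<open>The determinant identity\<close>

theorem theorem5p2:
  fixes E :: "'a set" and r :: nat and f :: "'a list \<Rightarrow> rat" and a b :: "'a list"
  assumes "finite E"
    and "r \<ge> 1"
    and "GP_function r E f"
    and "a \<in> nlists r E"
    and "b \<in> nlists r E"
  shows "(\<Sum>\<sigma> | \<sigma> permutes {..<r}. of_int (sign \<sigma>) * (\<Prod>i<r. f (a[i := b ! \<sigma> i])))
           = f a ^ (r - 1) * f b"
proof -
  note gp = assms(3) and a = assms(4) and b = assms(5)
  have alt: "alternating_on r E f"
    using gp by (simp add: GP_function_def)
  have len: "length a = r"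
    using a by simp
  define M where "M = mat r r (\<lambda>(i, j). f (a[i := b ! j]))"
  have M: "M \<in> carrier_mat r r"
    by (simp add: M_def)
  have M_index: "M $$ (i, j) = f (a[i := b ! j])" if "i < r" "j < r" for i j
    using that by (simp add: M_def)
  have det_rows: "det M = (\<Sum>\<sigma> | \<sigma> permutes {..<r}. of_int (sign \<sigma>) * (\<Prod>i<r. f (a[i := b ! \<sigma> i])))"
    unfolding det_def'[OF M] atLeast0LessThan
  proof (rule sum.cong[OF refl])
    fix \<sigma> assume "\<sigma> \<in> {\<sigma>. \<sigma> permutes {..<r}}"
    then have "\<sigma> i < r" if "i < r" for i
      using that permutes_in_image[of \<sigma> "{..<r}" i] by simp
    then show "of_int (sign \<sigma>) * (\<Prod>i<r. M $$ (i, \<sigma> i)) = of_int (sign \<sigma>) * (\<Prod>i<r. f (a[i := b ! \<sigma> i]))"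
      by (simp add: M_index)
  qed
  \<comment> \<open>The expansion picks a row \<open>g j\<close> for each column \<open>j\<close>,
    so it matches the Leibniz formula with the permutation acting on rows.\<close>
  have det_cols: "det M = (\<Sum>\<sigma> | \<sigma> permutes {..<r}. of_int (sign \<sigma>) * (\<Prod>j<r. f (a[\<sigma> j := b ! j])))"
    unfolding det_col[OF M] atLeast0LessThan
  proof (rule sum.cong[OF refl])
    fix \<sigma> assume "\<sigma> \<in> {\<sigma>. \<sigma> permutes {..<r}}"
    then have "\<sigma> i < r" if "i < r" for i
      using that permutes_in_image[of \<sigma> "{..<r}" i] by simp
    then show "of_int (sign \<sigma>) * (\<Prod>j<r. M $$ (\<sigma> j, j)) = of_int (sign \<sigma>) * (\<Prod>j<r. f (a[\<sigma> j := b ! j]))"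
      by (simp add: M_index)
  qed
  have "det M = f a ^ (r - 1) * f b"
  proof (cases "f a = 0")
    case False
    have "f a ^ r * f b = (\<Sum>g\<in>index_functions r r. (\<Prod>j<r. f (a[g j := b ! j]))
        * f (map (\<lambda>j. a ! g j) [0..<r]))"
    proof -
      have eq: "map (\<lambda>j. if j < r then a ! g j else b ! j) [0..<r] = map (\<lambda>j. a ! g j) [0..<r]" for g
        by simp
      then show ?thesis
        using GP_function_expand[OF gp a b order_refl] by (simp only: eq)
    qed
    also have "\<dots> = (\<Sum>g\<in>index_functions r r. if g permutes {..<r}
        then of_int (sign g) * (\<Prod>j<r. f (a[g j := b ! j])) * f a else 0)"
      by (intro sum.cong refl) (simp add: alternating_on_index_function[OF alt a])
    also have "\<dots> = (\<Sum>g | g permutes {..<r}. of_int (sign g) * (\<Prod>j<r. f (a[g j := b ! j])) * f a)"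
      using permutes_index_functions[of r]
      by (intro sum.mono_neutral_cong_right finite_index_functions) auto
    also have "\<dots> = det M * f a"
      by (simp add: det_cols sum_distrib_right)
    finally have "det M * f a = f a ^ r * f b" by simp
    \<comment> \<open>As \<open>r\<close> is positive, one factor \<open>f a\<close> splits off and
      cancels against the one next to \<open>det M\<close>.\<close>
    also have "f a ^ r = f a ^ (r - 1) * f a"
      using assms(2) by (cases r) simp_all
    finally show ?thesis
      using False by simp
  next
    case zero: True
    show ?thesis
    \<comment> \<open>For \<open>r = 1\<close> the power is \<open>0 ^ 0 = 1\<close> and both sides
      equal \<open>f b\<close>. For larger \<open>r\<close> the right-hand side vanishes, so
      \<open>M\<close> has to be singular.\<close>
    proof (cases "r = 1")
      case True
      have "length b = 1" "length a = 1"
        using a b True by simp_all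
      then obtain x y where "a = [x]" "b = [y]"
        by (auto simp: length_Suc_conv)
      moreover have "{\<sigma>. \<sigma> permutes {..<r}} = {id}"
        using True by (simp add: lessThan_Suc)
      ultimately show ?thesis
        using True by (simp add: det_rows)
    next
      case False
      then have r: "r \<ge> 2" using assms(2) by simp
      have "det M = 0"
      proof (cases "\<exists>i<r. \<exists>j<r. f (a[i := b ! j]) \<noteq> 0")
        case True
        then obtain i j where ij: "i < r" "j < r" "f (a[i := b ! j]) \<noteq> 0" by blast
        define c where "c = a[i := b ! j]"
        have c: "c \<in> nlists r E"
          unfolding c_def using a nlistsE_nth_in[OF b ij(2)] by simp
        \<comment> \<open>Any index other than \<open>i\<close> serves; one exists because
          \<open>r \<ge> 2\<close>. Since \<open>c\<close> differs from \<open>a\<close> at most at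
          \<open>i\<close>, its entry at \<open>p\<close> is still \<open>a ! p\<close>.\<close>
        define p where "p = (if i = 0 then 1 else 0 :: nat)"
        have p: "p < r" "p \<noteq> i" using r by (auto simp: p_def)
        define v where "v = vec r (\<lambda>k. f (c[p := a ! k]))"
        have "c[p := a ! p] = c"
          using p list_update_id[of c p] by (simp add: c_def)
        then have "v $ p = f c"
          using p by (simp add: v_def)
        then have "v \<noteq> 0\<^sub>v r"
          using p ij(3) c_def by fastforce
        moreover have "transpose_mat M *\<^sub>v v = 0\<^sub>v r"
        proof (rule eq_vecI)
          fix l assume "l < dim_vec (0\<^sub>v r :: rat vec)"
          then have l: "l < r" by simp
          have "(transpose_mat M *\<^sub>v v) $ l = (\<Sum>k<r. f (a[k := b ! l]) * f (c[p := a ! k]))"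
            using l by (simp add: M_def v_def scalar_prod_def atLeast0LessThan)
          \<comment> \<open>This sum is the right-hand side of Cramer's rule with
            \<open>u = b ! l\<close>; the left-hand side has the factor
            \<open>f a = 0\<close>.\<close>
          also have "\<dots> = 0"
            using GP_function_cramer[OF gp a c nlistsE_nth_in[OF b l] p(1)] zero by simp
          finally show "(transpose_mat M *\<^sub>v v) $ l = 0\<^sub>v r $ l"
            using l by simp
        qed (simp add: M_def)
        moreover have "v \<in> carrier_vec r" by (simp add: v_def)
        moreover have "transpose_mat M \<in> carrier_mat r r" using M by simp
        ultimately have "det (transpose_mat M) = 0"
          using det_0_iff_vec_prod_zero_field by blast
        then show ?thesis
          using det_transpose[OF M] by simp
      next
        case False
        have "M = 0\<^sub>m r r"
        proof (rule eq_matI)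
          fix i j assume "i < dim_row (0\<^sub>m r r :: rat mat)" "j < dim_col (0\<^sub>m r r :: rat mat)"
          then have "i < r" "j < r" by simp_all
          then show "M $$ (i, j) = 0\<^sub>m r r $$ (i, j)"
            using False M_index by force
        qed (simp_all add: M_def)
        \<comment> \<open>A zero matrix has determinant 0 only in positive dimension; the empty one
          has determinant 1.\<close>
        then show ?thesis
          using r by (simp add: det_zero)
      qed
      then show ?thesis
        using zero r by simp
    qed
  qed
  then show ?thesis
    by (simp add: det_rows)
qed

end
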